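(* Consider the log-linearized general equilibrium system described in the context, with $\hat s>0$, $\sigma_R\neq0$, and $\sigma_X,\sigma_E$ not both zero. Let $$B\equiv \theta_{RK}+\alpha_R\theta_{RQ},\qquad C\equiv \alpha_X\theta_{ER}\sigma_X+(\alpha_F+\alpha_X\theta_{EF})\sigma_E,\qquad \Theta\equiv 1-\sigma_E\left(\frac{B}{\theta_{RK}C}\right).$$ If the proportional change in emissions satisfies $\hat Z>0$, then one of the following conditions must hold: (i) $\hat F>0$ and $\hat K_X\le0$; or (ii) $\hat F\le0$ and $\hat K_X>0$. A necessary condition for each is as follows: condition (i) requires $\Theta>0$; condition (ii) requires $\Theta<0$ and $\alpha_F\theta_{RK}|\Theta|>\alpha_R$. Also, $\hat F>0$ and $\hat K_X>0$ cannot both hold.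
   Context: Initial equilibrium. The following level values are positive reals: capital uses $K_X,K_R,K_F$ with $\bar K=K_X+K_R+K_F$; a fixed factor $\bar Q$; quantities $X$ (final good), $E$ (energy), $R$ (renewable energy), $F$ (fossil energy, $F=K_F$); prices $P_X=1,P_E,P_R,P_F,P_K,P_Q$; an ad valorem capital tax $t$ and a per-unit offset payment $s$. They satisfy the zero-profit conditions $P_XX=(1+t)P_KK_X+P_EE$, $P_EE=P_FF+P_RR$, $(P_R+s)R=(1+t)P_KK_R+P_Q\bar Q$, $P_FF=(1+t)P_KK_F$, and the balanced government budget $tP_K\bar K=sR$. Share parameters: $\alpha_i=K_i/\bar K$ for $i\in\{X,R,F\}$; $\theta_{XK}=\frac{(1+t)P_KK_X}{P_XX}$, $\theta_{XE}=\frac{P_EE}{P_XX}$, $\theta_{EF}=\frac{P_FF}{P_EE}$, $\theta_{ER}=\frac{P_RR}{P_EE}$, $\theta_{RK}=\frac{(1+t)P_KK_R}{(P_R+s)R}$, $\theta_{RQ}=\frac{P_Q\bar Q}{(P_R+s)R}$, $\gamma=\frac{s}{P_R+s}$, $\psi=\frac{1+t}{t}$. Elasticities of substitution $\sigma_X,\sigma_E,\sigma_R\ge 0$ are given parameters. Log-linear system. Hatted variables denote small proportional changes and are the real unknowns of a linear system ($\hat t=dt/(1+t)$, $\hat s=ds/s$). Given exogenous $\hat s$, the 14 unknowns $\hat K_X,\hat K_R,\hat K_F,\hat X,\hat E,\hat F,\hat R,\hat P_K,\hat P_X,\hat P_E,\hat P_F,\hat P_R,\hat P_Q,\hat t$ solve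 the 14 equations: $0=\alpha_X\hat K_X+\alpha_R\hat K_R+\alpha_F\hat K_F$; $\hat X=\theta_{XK}\hat K_X+\theta_{XE}\hat E$; $\hat P_X+\hat X=\theta_{XK}(\hat t+\hat P_K+\hat K_X)+\theta_{XE}(\hat P_E+\hat E)$; $\hat K_X-\hat E=\sigma_X(\hat P_E-\hat t-\hat P_K)$; $\hat E=\theta_{EF}\hat F+\theta_{ER}\hat R$; $\hat P_E+\hat E=\theta_{EF}(\hat P_F+\hat F)+\theta_{ER}(\hat P_R+\hat R)$; $\hat R-\hat F=\sigma_E(\hat P_F-\hat P_R)$; $\hat R=\theta_{RK}\hat K_R$; $(1-\gamma)\hat P_R+\gamma\hat s+\hat R=\theta_{RK}(\hat t+\hat P_K+\hat K_R)+\theta_{RQ}\hat P_Q$; $\hat K_R=\sigma_R(\hat P_Q-\hat t-\hat P_K)$; $\hat F=\hat K_F$; $\hat P_F+\hat F=\hat t+\hat P_K+\hat K_F$; $\hat s+\hat R=\psi\hat t+\hat P_K$; $\hat P_X=0$. Emissions: with emission factors $\xi_F,\xi_X\ge0$ and $Z=\xi_FF+\xi_XK_X>0$, set $\rho_F=\xi_FF/Z$ and $\rho_X=\xi_XK_X/Z$, so $\rho_F+\rho_X=1$; the proportional change in emissions is $\hat Z=\rho_F\hat F+\rho_X\hat K_X$. *)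

theory Defs
  imports Complex_Main
begin

text \<open>
  Levels at the initial equilibrium. Sector \<open>X\<close> produces the final good, \<open>E\<close> is energy,
  \<open>R\<close> renewable energy, \<open>F\<close> fossil energy, \<open>K\<close> capital and \<open>Q\<close> the fixed factor used with
  capital in sector \<open>R\<close>.
\<close>
record economy =
  cap_X :: real
  cap_R :: real
  cap_F :: real
  fixed_Q :: real
  qty_X :: real
  qty_E :: real
  qty_R :: real
  qty_F :: real
  price_X :: real
  price_E :: real
  price_R :: real
  price_F :: real
  price_K :: real
  price_Q :: real
  tax :: real     \<comment> \<open>ad valorem tax \<open>t\<close> on capital\<close>
  offset :: real  \<comment> \<open>payment \<open>s\<close> per unit of renewable energy\<close>

definition cap_total :: "economy \<Rightarrow> real" where
  "cap_total e = cap_X e + cap_R e + cap_F e"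

definition initial_equilibrium :: "economy \<Rightarrow> bool" where
  "initial_equilibrium e \<longleftrightarrow>
     cap_X e > 0 \<and> cap_R e > 0 \<and> cap_F e > 0 \<and> fixed_Q e > 0 \<and>
     qty_X e > 0 \<and> qty_E e > 0 \<and> qty_R e > 0 \<and> qty_F e > 0 \<and>
     price_X e > 0 \<and> price_E e > 0 \<and> price_R e > 0 \<and> price_F e > 0 \<and>
     price_K e > 0 \<and> price_Q e > 0 \<and> tax e > 0 \<and> offset e > 0 \<and>
     price_X e = 1 \<and>
     qty_F e = cap_F e \<and>
     price_X e * qty_X e = (1 + tax e) * price_K e * cap_X e + price_E e * qty_E e \<and>
     price_E e * qty_E e = price_F e * qty_F e + price_R e * qty_R e \<and>
     (price_R e + offset e) * qty_R e
       = (1 + tax e) * price_K e * cap_R e + price_Q e * fixed_Q e \<and>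
     price_F e * qty_F e = (1 + tax e) * price_K e * cap_F e \<and>
     tax e * price_K e * cap_total e = offset e * qty_R e"

definition \<alpha>_X :: "economy \<Rightarrow> real" where "\<alpha>_X e = cap_X e / cap_total e"
definition \<alpha>_R :: "economy \<Rightarrow> real" where "\<alpha>_R e = cap_R e / cap_total e"
definition \<alpha>_F :: "economy \<Rightarrow> real" where "\<alpha>_F e = cap_F e / cap_total e"

definition \<theta>_XK :: "economy \<Rightarrow> real" where
  "\<theta>_XK e = (1 + tax e) * price_K e * cap_X e / (price_X e * qty_X e)"
definition \<theta>_XE :: "economy \<Rightarrow> real" where
  "\<theta>_XE e = price_E e * qty_E e / (price_X e * qty_X e)"
definition \<theta>_EF :: "economy \<Rightarrow> real" where
  "\<theta>_EF e = price_F e * qty_F e / (price_E e * qty_E e)"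
definition \<theta>_ER :: "economy \<Rightarrow> real" where
  "\<theta>_ER e = price_R e * qty_R e / (price_E e * qty_E e)"
definition \<theta>_RK :: "economy \<Rightarrow> real" where
  "\<theta>_RK e = (1 + tax e) * price_K e * cap_R e / ((price_R e + offset e) * qty_R e)"
definition \<theta>_RQ :: "economy \<Rightarrow> real" where
  "\<theta>_RQ e = price_Q e * fixed_Q e / ((price_R e + offset e) * qty_R e)"

definition \<gamma>_share :: "economy \<Rightarrow> real" where
  "\<gamma>_share e = offset e / (price_R e + offset e)"
definition \<psi>_tax :: "economy \<Rightarrow> real" where
  "\<psi>_tax e = (1 + tax e) / tax e"

text \<open>
  The unknowns of the log-linear system: proportional changes, except that \<open>hat_t\<close> stands for
  \<open>dt / (1 + t)\<close>.
\<close>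
record changes =
  hat_K_X :: real
  hat_K_R :: real
  hat_K_F :: real
  hat_X :: real
  hat_E :: real
  hat_F :: real
  hat_R :: real
  hat_P_K :: real
  hat_P_X :: real
  hat_P_E :: real
  hat_P_F :: real
  hat_P_R :: real
  hat_P_Q :: real
  hat_t :: real

text \<open>
  The arguments \<open>\<sigma>\<^sub>X \<sigma>\<^sub>E \<sigma>\<^sub>R\<close> are the elasticities of substitution in the three production
  functions, and \<open>hat_s\<close> is the exogenous change \<open>ds / s\<close>.
\<close>
definition loglinear_system ::
  "economy \<Rightarrow> real \<Rightarrow> real \<Rightarrow> real \<Rightarrow> real \<Rightarrow> changes \<Rightarrow> bool" where
  "loglinear_system e \<sigma>\<^sub>X \<sigma>\<^sub>E \<sigma>\<^sub>R hat_s h \<longleftrightarrow>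
     0 = \<alpha>_X e * hat_K_X h + \<alpha>_R e * hat_K_R h + \<alpha>_F e * hat_K_F h \<and>
     hat_X h = \<theta>_XK e * hat_K_X h + \<theta>_XE e * hat_E h \<and>
     hat_P_X h + hat_X h
       = \<theta>_XK e * (hat_t h + hat_P_K h + hat_K_X h) + \<theta>_XE e * (hat_P_E h + hat_E h) \<and>
     hat_K_X h - hat_E h = \<sigma>\<^sub>X * (hat_P_E h - hat_t h - hat_P_K h) \<and>
     hat_E h = \<theta>_EF e * hat_F h + \<theta>_ER e * hat_R h \<and>
     hat_P_E h + hat_E h
       = \<theta>_EF e * (hat_P_F h + hat_F h) + \<theta>_ER e * (hat_P_R h + hat_R h) \<and>
     hat_R h - hat_F h = \<sigma>\<^sub>E * (hat_P_F h - hat_P_R h) \<and>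
     hat_R h = \<theta>_RK e * hat_K_R h \<and>
     (1 - \<gamma>_share e) * hat_P_R h + \<gamma>_share e * hat_s + hat_R h
       = \<theta>_RK e * (hat_t h + hat_P_K h + hat_K_R h) + \<theta>_RQ e * hat_P_Q h \<and>
     hat_K_R h = \<sigma>\<^sub>R * (hat_P_Q h - hat_t h - hat_P_K h) \<and>
     hat_F h = hat_K_F h \<and>
     hat_P_F h + hat_F h = hat_t h + hat_P_K h + hat_K_F h \<and>
     hat_s + hat_R h = \<psi>_tax e * hat_t h + hat_P_K h \<and>
     hat_P_X h = 0"

text \<open>
  Emissions from fossil energy and from capital in sector \<open>X\<close>, with emission factors
  \<open>\<xi>\<^sub>F\<close> and \<open>\<xi>\<^sub>X\<close>.
\<close>
definition emissions :: "economy \<Rightarrow> real \<Rightarrow> real \<Rightarrow> real" where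
  "emissions e \<xi>\<^sub>F \<xi>\<^sub>X = \<xi>\<^sub>F * qty_F e + \<xi>\<^sub>X * cap_X e"

definition \<rho>_F :: "economy \<Rightarrow> real \<Rightarrow> real \<Rightarrow> real" where
  "\<rho>_F e \<xi>\<^sub>F \<xi>\<^sub>X = \<xi>\<^sub>F * qty_F e / emissions e \<xi>\<^sub>F \<xi>\<^sub>X"
definition \<rho>_X :: "economy \<Rightarrow> real \<Rightarrow> real \<Rightarrow> real" where
  "\<rho>_X e \<xi>\<^sub>F \<xi>\<^sub>X = \<xi>\<^sub>X * cap_X e / emissions e \<xi>\<^sub>F \<xi>\<^sub>X"

definition hat_Z :: "economy \<Rightarrow> real \<Rightarrow> real \<Rightarrow> changes \<Rightarrow> real" where
  "hat_Z e \<xi>\<^sub>F \<xi>\<^sub>X h = \<rho>_F e \<xi>\<^sub>F \<xi>\<^sub>X * hat_F h + \<rho>_X e \<xi>\<^sub>F \<xi>\<^sub>X * hat_K_X h"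

definition B_coeff :: "economy \<Rightarrow> real" where
  "B_coeff e = \<theta>_RK e + \<alpha>_R e * \<theta>_RQ e"

definition C_coeff :: "economy \<Rightarrow> real \<Rightarrow> real \<Rightarrow> real" where
  "C_coeff e \<sigma>\<^sub>X \<sigma>\<^sub>E = \<alpha>_X e * \<theta>_ER e * \<sigma>\<^sub>X + (\<alpha>_F e + \<alpha>_X e * \<theta>_EF e) * \<sigma>\<^sub>E"

definition \<Theta> :: "economy \<Rightarrow> real \<Rightarrow> real \<Rightarrow> real" where
  "\<Theta> e \<sigma>\<^sub>X \<sigma>\<^sub>E = 1 - \<sigma>\<^sub>E * (B_coeff e / (\<theta>_RK e * C_coeff e \<sigma>\<^sub>X \<sigma>\<^sub>E))"

end

theory Submission
  imports Defs
begin

text \<open>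
  Every quantity change is a multiple of the relative price \<open>p = hat_P_F - hat_P_R\<close>: capital
  clearing gives \<open>hat_R * B = \<theta>_RK * C * p\<close>, hence \<open>hat_F = \<Theta> * hat_R\<close>. The zero-profit
  condition of the renewable sector then writes \<open>\<gamma> * hat_s\<close> as a positive multiple of
  \<open>hat_R\<close>, so \<open>hat_R > 0\<close> and all signs can be read off.
\<close>

lemma initial_equilibrium_pos:
  assumes "initial_equilibrium e"
  shows "\<alpha>_X e > 0" "\<alpha>_R e > 0" "\<alpha>_F e > 0"
    and "\<theta>_XE e > 0" "\<theta>_EF e > 0" "\<theta>_ER e > 0" "\<theta>_RK e > 0" "\<theta>_RQ e > 0"
    and "0 < \<gamma>_share e" "\<gamma>_share e < 1"
proof -
  have "cap_X e > 0" "cap_R e > 0" "cap_F e > 0" "fixed_Q e > 0"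
    "qty_X e > 0" "qty_E e > 0" "qty_R e > 0" "qty_F e > 0"
    "price_X e > 0" "price_E e > 0" "price_R e > 0" "price_F e > 0"
    "price_K e > 0" "price_Q e > 0" "tax e > 0" "offset e > 0"
    using assms unfolding initial_equilibrium_def by blast+
  then show "\<alpha>_X e > 0" "\<alpha>_R e > 0" "\<alpha>_F e > 0"
    and "\<theta>_XE e > 0" "\<theta>_EF e > 0" "\<theta>_ER e > 0" "\<theta>_RK e > 0" "\<theta>_RQ e > 0"
    and "0 < \<gamma>_share e" "\<gamma>_share e < 1"
    unfolding cap_total_def \<alpha>_X_def \<alpha>_R_def \<alpha>_F_def
      \<theta>_XE_def \<theta>_EF_def \<theta>_ER_def \<theta>_RK_def \<theta>_RQ_def \<gamma>_share_def
    by simp_all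
qed

lemma initial_equilibrium_sum_eq_1:
  assumes "initial_equilibrium e"
  shows "\<alpha>_X e + \<alpha>_R e + \<alpha>_F e = 1"
    and "\<theta>_XK e + \<theta>_XE e = 1"
    and "\<theta>_EF e + \<theta>_ER e = 1"
    and "\<theta>_RK e + \<theta>_RQ e = 1"
proof -
  note eq = assms[unfolded initial_equilibrium_def]
  have "cap_total e > 0"
    using eq by (simp add: cap_total_def)
  then show "\<alpha>_X e + \<alpha>_R e + \<alpha>_F e = 1"
    by (simp add: \<alpha>_X_def \<alpha>_R_def \<alpha>_F_def cap_total_def flip: add_divide_distrib)
  have "price_X e > 0" "price_E e > 0" "price_R e > 0" "offset e > 0"
    "qty_X e > 0" "qty_E e > 0" "qty_R e > 0"
    using eq by blast+
  \<comment> \<open>The zero-profit conditions are oriented with the cost sum on the left, so that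
    they match the numerators once each pair of shares is put over its common denominator.\<close>
  moreover have
    "(1 + tax e) * price_K e * cap_X e + price_E e * qty_E e = price_X e * qty_X e"
    "price_F e * qty_F e + price_R e * qty_R e = price_E e * qty_E e"
    "(1 + tax e) * price_K e * cap_R e + price_Q e * fixed_Q e
       = (price_R e + offset e) * qty_R e"
    using eq by argo+
  ultimately show "\<theta>_XK e + \<theta>_XE e = 1" and "\<theta>_EF e + \<theta>_ER e = 1"
    and "\<theta>_RK e + \<theta>_RQ e = 1"
    unfolding \<theta>_XK_def \<theta>_XE_def \<theta>_EF_def \<theta>_ER_def \<theta>_RK_def \<theta>_RQ_def
    by (simp_all only: flip: add_divide_distrib) simp_all
qed

lemma B_coeff_pos:
  assumes "initial_equilibrium e"
  shows "B_coeff e > 0"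
  using initial_equilibrium_pos[OF assms] by (simp add: B_coeff_def add_pos_pos)

lemma C_coeff_pos:
  assumes "initial_equilibrium e" "\<sigma>\<^sub>X \<ge> 0" "\<sigma>\<^sub>E \<ge> 0" "\<not> (\<sigma>\<^sub>X = 0 \<and> \<sigma>\<^sub>E = 0)"
  shows "C_coeff e \<sigma>\<^sub>X \<sigma>\<^sub>E > 0"
\<comment> \<open>The split decides which of the two summands is strictly positive; the other is
  only nonnegative in general.\<close>
proof (cases "\<sigma>\<^sub>X = 0")
  case True
  then show ?thesis
    using assms initial_equilibrium_pos[OF assms(1)] by (simp add: C_coeff_def add_pos_pos)
next
  case False
  then show ?thesis
    using assms initial_equilibrium_pos[OF assms(1)]
    by (simp add: C_coeff_def add_pos_nonneg)
qed

text \<open>Fossil energy is made from capital alone, so \<open>hat_P_F\<close> equals the change in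
  the taxed cost of capital. Quantities cancel from the zero-profit conditions of \<open>E\<close>
  and \<open>X\<close>, leaving two price-index equations. With the final good as numeraire, these
  determine the cost of capital from the relative price.\<close>

lemma capital_cost_relative_price:
  assumes "initial_equilibrium e" "loglinear_system e \<sigma>\<^sub>X \<sigma>\<^sub>E \<sigma>\<^sub>R hat_s h"
  shows "hat_t h + hat_P_K h = \<theta>_XE e * \<theta>_ER e * (hat_P_F h - hat_P_R h)"
    and "hat_P_E h - hat_t h - hat_P_K h = - (\<theta>_ER e * (hat_P_F h - hat_P_R h))"
proof -
  note sys = assms(2)[unfolded loglinear_system_def]
  note sums = initial_equilibrium_sum_eq_1[OF assms(1)]
  define w where "w = hat_t h + hat_P_K h"
  have PF: "hat_P_F h = w"
    using sys unfolding w_def by argo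
  have "hat_P_E h = \<theta>_EF e * hat_P_F h + \<theta>_ER e * hat_P_R h"
    using sys by (simp add: distrib_left)
  moreover have "\<theta>_EF e = 1 - \<theta>_ER e"
    using sums by simp
  ultimately have PE: "hat_P_E h - w = - (\<theta>_ER e * (hat_P_F h - hat_P_R h))"
    using PF by (simp add: algebra_simps)
  then show "hat_P_E h - hat_t h - hat_P_K h = - (\<theta>_ER e * (hat_P_F h - hat_P_R h))"
    by (simp add: w_def)
  have "\<theta>_XK e * w + \<theta>_XE e * hat_P_E h = 0"
    using sys by (simp add: distrib_left w_def)
  moreover have "\<theta>_XK e = 1 - \<theta>_XE e"
    using sums by simp
  ultimately have "w = - (\<theta>_XE e * (hat_P_E h - w))"
    by (simp add: algebra_simps)
  then show "hat_t h + hat_P_K h = \<theta>_XE e * \<theta>_ER e * (hat_P_F h - hat_P_R h)"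
    unfolding PE by (simp add: w_def mult.assoc)
qed

lemma capital_clearing:
  assumes "loglinear_system e \<sigma>\<^sub>X \<sigma>\<^sub>E \<sigma>\<^sub>R hat_s h"
  shows "\<alpha>_X e * hat_K_X h + \<alpha>_R e * hat_K_R h + \<alpha>_F e * hat_F h = 0"
  using assms unfolding loglinear_system_def by metis

text \<open>Both \<open>hat_F\<close> and \<open>hat_K_X\<close> equal \<open>hat_R\<close> minus a
  substitution term proportional to the relative price. In capital clearing, scaled by
  \<open>\<theta>_RK\<close>, the terms in \<open>hat_R\<close> collect to \<open>B_coeff\<close>
  and the substitution terms to \<open>C_coeff\<close>.\<close>

lemma hat_R_relative_price:
  assumes "initial_equilibrium e" "loglinear_system e \<sigma>\<^sub>X \<sigma>\<^sub>E \<sigma>\<^sub>R hat_s h"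
  shows "hat_R h * B_coeff e = \<theta>_RK e * C_coeff e \<sigma>\<^sub>X \<sigma>\<^sub>E * (hat_P_F h - hat_P_R h)"
proof -
  note sys = assms(2)[unfolded loglinear_system_def]
  note sums = initial_equilibrium_sum_eq_1[OF assms(1)]
  define p where "p = hat_P_F h - hat_P_R h"
  have F: "hat_F h = hat_R h - \<sigma>\<^sub>E * p"
    using sys unfolding p_def by argo
  have "hat_K_X h - hat_E h = \<sigma>\<^sub>X * - (\<theta>_ER e * p)"
    using sys capital_cost_relative_price(2)[OF assms] unfolding p_def by metis
  then have "hat_K_X h = \<theta>_EF e * hat_F h + \<theta>_ER e * hat_R h - \<sigma>\<^sub>X * (\<theta>_ER e * p)"
    using sys by simp
  also have "\<dots> = (\<theta>_EF e + \<theta>_ER e) * hat_R h - (\<theta>_EF e * \<sigma>\<^sub>E + \<theta>_ER e * \<sigma>\<^sub>X) * p"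
    unfolding F by (simp add: algebra_simps)
  finally have KX: "hat_K_X h = hat_R h - (\<theta>_EF e * \<sigma>\<^sub>E + \<theta>_ER e * \<sigma>\<^sub>X) * p"
    using sums by simp
  have R: "hat_R h = \<theta>_RK e * hat_K_R h"
    using sys by simp
  \<comment> \<open>This is the shape in which the coefficient arises from capital clearing; the
    summand \<alpha>_R comes from \<open>\<theta>_RK * hat_K_R = hat_R\<close>.\<close>
  have "B_coeff e = \<theta>_RK e * (\<alpha>_X e + \<alpha>_F e) + \<alpha>_R e"
  proof -
    have "\<theta>_RQ e = 1 - \<theta>_RK e" and "\<alpha>_X e + \<alpha>_F e = 1 - \<alpha>_R e"
      using sums by simp_all
    then show ?thesis
      unfolding B_coeff_def \<open>\<theta>_RQ e = _\<close> \<open>\<alpha>_X e + \<alpha>_F e = _\<close>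
      by (simp only: algebra_simps mult_1_right)
  qed
  then have "hat_R h * B_coeff e
      = \<theta>_RK e * ((\<alpha>_X e + \<alpha>_F e) * hat_R h + \<alpha>_R e * hat_K_R h)"
    using R by (simp add: algebra_simps)
  \<comment> \<open>Eliminating \<open>hat_K_R\<close> by clearing leaves only the gaps to
    \<open>hat_R\<close>, which are pure substitution terms.\<close>
  also have "\<dots> = \<theta>_RK e * (\<alpha>_X e * (hat_R h - hat_K_X h) + \<alpha>_F e * (hat_R h - hat_F h))"
  proof -
    have KR: "\<alpha>_R e * hat_K_R h = - (\<alpha>_X e * hat_K_X h) - \<alpha>_F e * hat_F h"
      using capital_clearing[OF assms(2)] by simp
    show ?thesis
      unfolding KR by (simp add: algebra_simps)
  qed
  also have "\<dots> = \<theta>_RK e * C_coeff e \<sigma>\<^sub>X \<sigma>\<^sub>E * p"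
    unfolding KX F C_coeff_def by (simp add: algebra_simps)
  finally show ?thesis
    by (simp add: p_def)
qed

text \<open>If \<open>hat_R\<close> were nonpositive, so would be the relative price, the cost of
  capital and \<open>hat_K_R\<close>. Renewable zero profit would then make the positive number
  \<open>\<gamma>_share * hat_s\<close> a sum of three nonpositive terms.\<close>

lemma hat_R_pos:
  assumes "initial_equilibrium e" "\<sigma>\<^sub>X \<ge> 0" "\<sigma>\<^sub>E \<ge> 0" "\<not> (\<sigma>\<^sub>X = 0 \<and> \<sigma>\<^sub>E = 0)"
    and "\<sigma>\<^sub>R > 0" "hat_s > 0" "loglinear_system e \<sigma>\<^sub>X \<sigma>\<^sub>E \<sigma>\<^sub>R hat_s h"
  shows "hat_R h > 0"
proof (rule ccontr)
  assume "\<not> hat_R h > 0"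
  then have R: "hat_R h \<le> 0"
    by simp
  note sys = assms(7)[unfolded loglinear_system_def]
  note pos = initial_equilibrium_pos[OF assms(1)]
  define p where "p = hat_P_F h - hat_P_R h"
  define w where "w = hat_t h + hat_P_K h"
  have "\<theta>_RK e * C_coeff e \<sigma>\<^sub>X \<sigma>\<^sub>E * p \<le> 0"
    using R B_coeff_pos[OF assms(1)] hat_R_relative_price[OF assms(1,7)]
    by (metis less_imp_le mult_nonpos_nonneg p_def)
  moreover have "\<theta>_RK e * C_coeff e \<sigma>\<^sub>X \<sigma>\<^sub>E > 0"
    using pos C_coeff_pos[OF assms(1-4)] by simp
  ultimately have p: "p \<le> 0"
    by (meson mult_pos_pos not_le)
  then have w: "w \<le> 0"
    using capital_cost_relative_price(1)[OF assms(1,7)] pos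
    by (simp add: w_def p_def mult_nonneg_nonpos)
  have KR: "hat_K_R h \<le> 0"
    using R sys pos by (simp add: mult_le_0_iff)
  \<comment> \<open>The substitution equation of the renewable sector can be solved for the fixed
    factor's price because \<open>\<sigma>\<^sub>R\<close> is positive.\<close>
  have PQ: "hat_P_Q h = w + hat_K_R h / \<sigma>\<^sub>R"
    using sys assms(5) by (simp add: w_def)
  have PR: "hat_P_R h = w - p"
    using sys by (simp add: w_def p_def)
  \<comment> \<open>The quantity terms cancel, since
    \<open>hat_R = \<theta>_RK * hat_K_R\<close>.\<close>
  have "(1 - \<gamma>_share e) * hat_P_R h + \<gamma>_share e * hat_s = \<theta>_RK e * w + \<theta>_RQ e * hat_P_Q h"
    using sys by (simp add: w_def distrib_left)
  also have "\<dots> = (\<theta>_RK e + \<theta>_RQ e) * w + \<theta>_RQ e * (hat_K_R h / \<sigma>\<^sub>R)"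
    unfolding PQ by (simp add: algebra_simps)
  finally have "\<gamma>_share e * hat_s
      = \<gamma>_share e * w + (1 - \<gamma>_share e) * p + \<theta>_RQ e * (hat_K_R h / \<sigma>\<^sub>R)"
    using initial_equilibrium_sum_eq_1(4)[OF assms(1)] unfolding PR by (simp add: algebra_simps)
  moreover have "\<gamma>_share e * w \<le> 0" "(1 - \<gamma>_share e) * p \<le> 0"
    using pos w p by (simp_all add: mult_nonneg_nonpos)
  moreover have "\<theta>_RQ e * (hat_K_R h / \<sigma>\<^sub>R) \<le> 0"
    using pos KR assms(5) by (intro mult_nonneg_nonpos divide_nonpos_pos) simp_all
  moreover have "\<gamma>_share e * hat_s > 0"
    using pos assms(6) by simp
  ultimately show False
    by linarith
qed

lemma hat_F_eq_Theta_hat_R: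
  assumes "initial_equilibrium e" "\<sigma>\<^sub>X \<ge> 0" "\<sigma>\<^sub>E \<ge> 0" "\<not> (\<sigma>\<^sub>X = 0 \<and> \<sigma>\<^sub>E = 0)"
    and "loglinear_system e \<sigma>\<^sub>X \<sigma>\<^sub>E \<sigma>\<^sub>R hat_s h"
  shows "hat_F h = \<Theta> e \<sigma>\<^sub>X \<sigma>\<^sub>E * hat_R h"
proof -
  have "\<theta>_RK e > 0" "C_coeff e \<sigma>\<^sub>X \<sigma>\<^sub>E > 0"
    using initial_equilibrium_pos[OF assms(1)] C_coeff_pos[OF assms(1-4)] by simp_all
  then have "hat_P_F h - hat_P_R h
      = B_coeff e / (\<theta>_RK e * C_coeff e \<sigma>\<^sub>X \<sigma>\<^sub>E) * hat_R h"
    using hat_R_relative_price[OF assms(1,5)] by (simp add: field_simps)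
  moreover have "hat_F h = hat_R h - \<sigma>\<^sub>E * (hat_P_F h - hat_P_R h)"
    using assms(5) unfolding loglinear_system_def by argo
  ultimately show ?thesis
    by (simp add: \<Theta>_def left_diff_distrib mult.assoc)
qed

theorem proposition3:
  fixes e :: economy and h :: changes
    and \<sigma>\<^sub>X \<sigma>\<^sub>E \<sigma>\<^sub>R hat_s \<xi>\<^sub>F \<xi>\<^sub>X :: real
  assumes "initial_equilibrium e"
    and "\<sigma>\<^sub>X \<ge> 0" and "\<sigma>\<^sub>E \<ge> 0" and "\<sigma>\<^sub>R \<ge> 0"
    and "\<sigma>\<^sub>R \<noteq> 0" and "\<not> (\<sigma>\<^sub>X = 0 \<and> \<sigma>\<^sub>E = 0)"
    and "\<xi>\<^sub>F \<ge> 0" and "\<xi>\<^sub>X \<ge> 0" and "emissions e \<xi>\<^sub>F \<xi>\<^sub>X > 0"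
    and "hat_s > 0"
    and "loglinear_system e \<sigma>\<^sub>X \<sigma>\<^sub>E \<sigma>\<^sub>R hat_s h"
  shows "(hat_Z e \<xi>\<^sub>F \<xi>\<^sub>X h > 0 \<longrightarrow>
            (hat_F h > 0 \<and> hat_K_X h \<le> 0) \<or> (hat_F h \<le> 0 \<and> hat_K_X h > 0)) \<and>
         (hat_F h > 0 \<and> hat_K_X h \<le> 0 \<longrightarrow> \<Theta> e \<sigma>\<^sub>X \<sigma>\<^sub>E > 0) \<and>
         (hat_F h \<le> 0 \<and> hat_K_X h > 0 \<longrightarrow>
            \<Theta> e \<sigma>\<^sub>X \<sigma>\<^sub>E < 0 \<and> \<alpha>_F e * \<theta>_RK e * \<bar>\<Theta> e \<sigma>\<^sub>X \<sigma>\<^sub>E\<bar> > \<alpha>_R e) \<and>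
         \<not> (hat_F h > 0 \<and> hat_K_X h > 0)"
proof -
  note sys = assms(11)[unfolded loglinear_system_def]
  note pos = initial_equilibrium_pos[OF assms(1)]
  let ?T = "\<Theta> e \<sigma>\<^sub>X \<sigma>\<^sub>E"
  have R: "hat_R h > 0"
    using assms by (intro hat_R_pos[of e \<sigma>\<^sub>X \<sigma>\<^sub>E \<sigma>\<^sub>R hat_s]) simp_all
  have F: "hat_F h = ?T * hat_R h"
    by (rule hat_F_eq_Theta_hat_R[OF assms(1-3,6,11)])
  have "\<alpha>_X e * hat_K_X h = - (\<alpha>_R e * hat_K_R h + \<alpha>_F e * hat_F h)"
    using capital_clearing[OF assms(11)] by simp
  \<comment> \<open>The factor \<theta>_RK turns \<open>hat_K_R\<close> into \<open>hat_R\<close>,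
    so that the right-hand side becomes a multiple of the positive number
    \<open>hat_R\<close>.\<close>
  then have "\<theta>_RK e * (\<alpha>_X e * hat_K_X h)
      = - (\<theta>_RK e * (\<alpha>_R e * hat_K_R h + \<alpha>_F e * hat_F h))"
    by (simp only: mult_minus_right)
  also have "\<dots> = - ((\<alpha>_R e + \<alpha>_F e * \<theta>_RK e * ?T) * hat_R h)"
    using sys F by (simp add: algebra_simps)
  finally have KX: "\<theta>_RK e * \<alpha>_X e * hat_K_X h
      = - ((\<alpha>_R e + \<alpha>_F e * \<theta>_RK e * ?T) * hat_R h)"
    by simp
  have F_pos: "hat_F h > 0 \<longleftrightarrow> ?T > 0"
    using R by (simp add: F zero_less_mult_iff)
  have KX_pos: "hat_K_X h > 0 \<longleftrightarrow> \<alpha>_R e + \<alpha>_F e * \<theta>_RK e * ?T < 0"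
  proof -
    have "\<theta>_RK e * \<alpha>_X e > 0"
      using pos by simp
    then have "hat_K_X h > 0 \<longleftrightarrow> \<theta>_RK e * \<alpha>_X e * hat_K_X h > 0"
      by (meson mult_pos_pos zero_less_mult_pos)
    then show ?thesis
      unfolding KX using R by (simp add: mult_less_0_iff)
  qed
  \<comment> \<open>As \<alpha>_R is positive, the inequality in \<open>KX_pos\<close> can only hold
    for negative \<open>?T\<close>; by \<open>F_pos\<close> this rules out that \<open>hat_F\<close>
    and \<open>hat_K_X\<close> are both positive.\<close>
  have T_neg: "?T < 0" if "hat_K_X h > 0"
  proof (rule ccontr)
    assume "\<not> ?T < 0"
    then have "\<alpha>_F e * \<theta>_RK e * ?T \<ge> 0"
      using pos by simp
    then show False
      using that KX_pos pos by linarith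
  qed
  have ZF: "hat_F h > 0 \<or> hat_K_X h > 0" if "hat_Z e \<xi>\<^sub>F \<xi>\<^sub>X h > 0"
  proof (rule ccontr)
    assume "\<not> (hat_F h > 0 \<or> hat_K_X h > 0)"
    moreover have "\<rho>_F e \<xi>\<^sub>F \<xi>\<^sub>X \<ge> 0" "\<rho>_X e \<xi>\<^sub>F \<xi>\<^sub>X \<ge> 0"
      using assms(1,7-9) by (simp_all add: \<rho>_F_def \<rho>_X_def initial_equilibrium_def)
    ultimately have "hat_Z e \<xi>\<^sub>F \<xi>\<^sub>X h \<le> 0"
      by (simp add: hat_Z_def add_nonpos_nonpos mult_nonneg_nonpos)
    with that show False
      by simp
  qed
  \<comment> \<open>For negative \<open>?T\<close>, the inequality in \<open>KX_pos\<close> is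
    exactly the bound on its absolute value required in case (ii).\<close>
  show ?thesis
    using F_pos KX_pos T_neg ZF by (auto simp: not_less)
qed

end
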